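(* For $n\ge 0$ and $m\geq 1$ put $A_{n,m}\equiv a_{n+1}^{*}a_{n+2}^{*}\cdots a_{n+m}^{*}$. Up to the vacuum vectors $\Omega_B,\Omega_F$ and a normalization constant, monomials of bosons and fermions are in one-to-one correspondence in the Fock spaces by $$(b_{n_1}^{*})^{k_1}\cdots(b_{n_m}^{*})^{k_m}\ \mapsto\ A_{n_1-1,\,k_1}A_{n_2+k_1-1,\,k_2}\cdots A_{n_m+k_1+\cdots+k_{m-1}-1,\,k_m}.$$ That is, this assignment (over all $m\geq1$, $1\leq n_1<\cdots<n_m$, $k_1,\ldots,k_m\geq 1$) is a bijection from the set of monomials $(b_{n_1}^{*})^{k_1}\cdots(b_{n_m}^{*})^{k_m}$ onto the set of monomials $a_{j_1}^*\cdots a_{j_l}^*$ with $l\ge1$, $1\le j_1<\cdots<j_l$, and the unitary $U:\mathcal H_B\to\mathcal H_F$ defined in the context maps the vector obtained by applying the boson monomial to $\Omega_B$ to a normalization constant times the vector obtained by applying the corresponding fermion monomial to $\Omega_F$.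
   Context: $\mathbf N=\{1,2,3,\ldots\}$. $\mathcal O_2$ is the Cuntz algebra with canonical generators $t_1,t_2$: $t_i^*t_j=\delta_{ij}I$, $t_1t_1^*+t_2t_2^*=I$. $\mathcal B$ is the $*$-algebra of bosons, generated by $\{b_n:n\in\mathbf N\}$ with $b_nb_m^*-b_m^*b_n=\delta_{nm}I$, $b_nb_m-b_mb_n=b_n^*b_m^*-b_m^*b_n^*=0$. $\mathcal A$ is the $*$-algebra of fermions, generated by $\{a_n:n\in\mathbf N\}$ with $a_na_m^*+a_m^*a_n=\delta_{nm}I$, $a_na_m+a_ma_n=a_n^*a_m^*+a_m^*a_n^*=0$. Fock representations: $(\mathcal H_B,\pi_B)$ is the Bose-Fock representation, i.e. a $*$-representation of $\mathcal B$ by operators on the dense subspace $\pi_B(\mathcal B)\Omega_B$ of the Hilbert space $\mathcal H_B$, with unit vector (vacuum) $\Omega_B$ satisfying $\pi_B(b_n)\Omega_B=0$ for all $n$. $(\mathcal H_F,\pi_F)$ is the Fermi-Fock representation, i.e. a $*$-representation of $\mathcal A$ on the Hilbert space $\mathcal H_F$ with unit vector (vacuum) $\Omega_F$ such that $\pi_F(\mathcal A)\Omega_F$ is dense and $\pi_F(a_n)\Omega_F=0$ for all $n$. One identifies $b_n$ with $\pi_B(b_n)$ and $a_n$ with $\pi_F(a_n)$. Definition of $U$: Let $(\mathcal H,\pi)$ be a unital $*$-representation of $\mathcal O_2$ with a cyclic unit vector $\Omega$ satisfying $\pi(t_1)\Omega=\Omega$ (it exists and is unique up to unitary equivalence); write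 $t_i$ for $\pi(t_i)$. Let $\mathcal D$ be the linear span of $\{t_{i_1}\cdots t_{i_m}\Omega: i_1,\ldots,i_m\in\{1,2\},\ m\ge1\}$, a dense subspace of $\mathcal H$. Put $s_m\equiv t_2^{m-1}t_1$ for $m\geq1$ ($t_2^0=I$). A representation $\pi_{RBS}$ of $\mathcal B$ on $\mathcal D$ is given by $$b_1=\sum_{m=1}^\infty\sqrt m\,s_ms_{m+1}^*,\qquad b_n=\rho(b_{n-1})\ (n\ge2),\qquad \rho(x)=\sum_{m=1}^\infty s_mxs_m^*,$$ (together with the adjoints; the sums are finite on each vector of $\mathcal D$). A representation $\pi_{RFS}$ of $\mathcal A$ on $\mathcal H$ is given by $$a_1=t_1t_2^*,\qquad a_n=\zeta(a_{n-1})\ (n\ge2),\qquad \zeta(y)=t_1yt_1^*-t_2yt_2^*.$$ It is known that there are unitaries $V_B:\mathcal H\to\mathcal H_B$ and $V_F:\mathcal H\to\mathcal H_F$ with $V_B\pi_{RBS}(\cdot)V_B^*=\pi_B$, $V_F\pi_{RFS}(\cdot)V_F^*=\pi_F$ (with $V_B\mathcal D=\pi_B(\mathcal B)\Omega_B$), $V_B\Omega=\Omega_B$ and $V_F\Omega=\Omega_F$; these properties determine them. Define $U\equiv V_FV_B^*$. *)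

theory Defs
  imports "HOL-Analysis.Analysis"
begin

section \<open>Complex Hilbert spaces and star-algebras\<close>

class complex_vector = real_vector +
  fixes scaleC :: "complex \<Rightarrow> 'a \<Rightarrow> 'a" (infixr "*\<^sub>C" 75)
  assumes scaleC_add_right: "c *\<^sub>C (x + y) = c *\<^sub>C x + c *\<^sub>C y"
    and scaleC_add_left: "(c + d) *\<^sub>C x = c *\<^sub>C x + d *\<^sub>C x"
    and scaleC_scaleC: "c *\<^sub>C (d *\<^sub>C x) = (c * d) *\<^sub>C x"
    and scaleC_one: "1 *\<^sub>C x = x"
    and scaleR_scaleC: "r *\<^sub>R x = complex_of_real r *\<^sub>C x"

global_interpretation complex_vector: vector_space "scaleC :: complex \<Rightarrow> 'a \<Rightarrow> 'a::complex_vector"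
  defines csubspace = "complex_vector.subspace :: 'a::complex_vector set \<Rightarrow> bool"
    and cspan = "complex_vector.span :: 'a::complex_vector set \<Rightarrow> 'a set"
  by standard (rule scaleC_add_right scaleC_add_left scaleC_scaleC scaleC_one)+

text \<open>The inner product is conjugate-linear in its first argument. Its positivity and definiteness
  follow from the norm axioms and the last assumption, as \<open>sqrt\<close> preserves signs.\<close>

class chilbert_space = complex_vector + banach +
  fixes cinner :: "'a \<Rightarrow> 'a \<Rightarrow> complex"
  assumes cinner_commute: "cinner x y = cnj (cinner y x)"
    and cinner_add_right: "cinner x (y + z) = cinner x y + cinner x z"
    and cinner_scaleC_right: "cinner x (c *\<^sub>C y) = c * cinner x y"
    and norm_eq_sqrt_cinner: "norm x = sqrt (Re (cinner x x))"

class star_algebra = complex_vector + ring_1 +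
  fixes star :: "'a \<Rightarrow> 'a"
  assumes mult_scaleC_left: "(c *\<^sub>C x) * y = c *\<^sub>C (x * y)"
    and mult_scaleC_right: "x * (c *\<^sub>C y) = c *\<^sub>C (x * y)"
    and star_add: "star (x + y) = star x + star y"
    and star_scaleC: "star (c *\<^sub>C x) = cnj c *\<^sub>C star x"
    and star_mult: "star (x * y) = star y * star x"
    and star_star: "star (star x) = x"

class cstar_algebra = star_algebra + real_normed_algebra_1 + banach +
  assumes cstar_identity: "norm (star x * x) = (norm x)\<^sup>2"

inductive_set star_generated :: "'a::star_algebra set \<Rightarrow> 'a set" for S where
  gen: "x \<in> S \<Longrightarrow> x \<in> star_generated S"
| one: "1 \<in> star_generated S"
| add: "x \<in> star_generated S \<Longrightarrow> y \<in> star_generated S \<Longrightarrow> x + y \<in> star_generated S"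
| scale: "x \<in> star_generated S \<Longrightarrow> c *\<^sub>C x \<in> star_generated S"
| mult: "x \<in> star_generated S \<Longrightarrow> y \<in> star_generated S \<Longrightarrow> x * y \<in> star_generated S"
| star: "x \<in> star_generated S \<Longrightarrow> star x \<in> star_generated S"


section \<open>The Cuntz algebra, bosons and fermions\<close>

text \<open>Families of generators are functions on \<open>nat\<close>; only the indices \<open>1, 2\<close> (Cuntz) and
  \<open>n \<ge> 1\<close> (bosons and fermions) are meaningful. The three algebras are simple, so a nonzero algebra
  that is generated by elements satisfying the relations is the universal one.\<close>

definition cuntz_generators :: "(nat \<Rightarrow> 'o::cstar_algebra) \<Rightarrow> bool" where
  "cuntz_generators t \<longleftrightarrow>
     (\<forall>i\<in>{1,2}. \<forall>j\<in>{1,2}. star (t i) * t j = (if i = j then 1 else 0)) \<and>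
     t 1 * star (t 1) + t 2 * star (t 2) = 1 \<and>
     closure (star_generated {t 1, t 2}) = UNIV"

definition boson_generators :: "(nat \<Rightarrow> 'b::star_algebra) \<Rightarrow> bool" where
  "boson_generators b \<longleftrightarrow>
     (\<forall>n\<ge>1. \<forall>m\<ge>1.
        b n * star (b m) - star (b m) * b n = (if n = m then 1 else 0) \<and>
        b n * b m - b m * b n = 0 \<and>
        star (b n) * star (b m) - star (b m) * star (b n) = 0) \<and>
     star_generated (b ` {1..}) = UNIV"

definition fermion_generators :: "(nat \<Rightarrow> 'a::star_algebra) \<Rightarrow> bool" where
  "fermion_generators a \<longleftrightarrow>
     (\<forall>n\<ge>1. \<forall>m\<ge>1.
        a n * star (a m) + star (a m) * a n = (if n = m then 1 else 0) \<and>
        a n * a m + a m * a n = 0 \<and>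
        star (a n) * star (a m) + star (a m) * star (a n) = 0) \<and>
     star_generated (a ` {1..}) = UNIV"


section \<open>Representations\<close>

text \<open>Operators with domain \<open>D\<close> are total functions whose values outside \<open>D\<close> are irrelevant.\<close>

definition star_rep :: "'h::chilbert_space set \<Rightarrow> ('x::star_algebra \<Rightarrow> 'h \<Rightarrow> 'h) \<Rightarrow> bool" where
  "star_rep D \<pi> \<longleftrightarrow>
     csubspace D \<and> closure D = UNIV \<and>
     (\<forall>x. \<forall>u\<in>D. \<pi> x u \<in> D) \<and>
     (\<forall>x. \<forall>u\<in>D. \<forall>v\<in>D. \<pi> x (u + v) = \<pi> x u + \<pi> x v) \<and>
     (\<forall>x c. \<forall>u\<in>D. \<pi> x (c *\<^sub>C u) = c *\<^sub>C \<pi> x u) \<and>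
     (\<forall>u\<in>D. \<pi> 1 u = u) \<and>
     (\<forall>x y. \<forall>u\<in>D. \<pi> (x + y) u = \<pi> x u + \<pi> y u) \<and>
     (\<forall>c x. \<forall>u\<in>D. \<pi> (c *\<^sub>C x) u = c *\<^sub>C \<pi> x u) \<and>
     (\<forall>x y. \<forall>u\<in>D. \<pi> (x * y) u = \<pi> x (\<pi> y u)) \<and>
     (\<forall>x. \<forall>u\<in>D. \<forall>v\<in>D. cinner (\<pi> x u) v = cinner u (\<pi> (star x) v))"

definition bounded_star_rep :: "('x::star_algebra \<Rightarrow> 'h::chilbert_space \<Rightarrow> 'h) \<Rightarrow> bool" where
  "bounded_star_rep \<pi> \<longleftrightarrow> star_rep UNIV \<pi> \<and> (\<forall>x. bounded_linear (\<pi> x))"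

definition orbit :: "('x::star_algebra \<Rightarrow> 'h::chilbert_space \<Rightarrow> 'h) \<Rightarrow> 'h \<Rightarrow> 'h set" where
  "orbit \<pi> \<Omega> = range (\<lambda>x. \<pi> x \<Omega>)"

text \<open>The condition \<open>\<Omega> \<in> orbit \<pi> \<Omega>\<close> is not redundant here: \<open>\<pi> 1\<close> is only known to be the
  identity on the domain.\<close>

definition bose_fock ::
  "(nat \<Rightarrow> 'b::star_algebra) \<Rightarrow> ('b \<Rightarrow> 'h::chilbert_space \<Rightarrow> 'h) \<Rightarrow> 'h \<Rightarrow> bool" where
  "bose_fock b \<pi> \<Omega> \<longleftrightarrow>
     star_rep (orbit \<pi> \<Omega>) \<pi> \<and> \<Omega> \<in> orbit \<pi> \<Omega> \<and> norm \<Omega> = 1 \<and> (\<forall>n\<ge>1. \<pi> (b n) \<Omega> = 0)"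

definition fermi_fock ::
  "(nat \<Rightarrow> 'a::star_algebra) \<Rightarrow> ('a \<Rightarrow> 'h::chilbert_space \<Rightarrow> 'h) \<Rightarrow> 'h \<Rightarrow> bool" where
  "fermi_fock a \<pi> \<Omega> \<longleftrightarrow>
     bounded_star_rep \<pi> \<and> closure (orbit \<pi> \<Omega>) = UNIV \<and> norm \<Omega> = 1 \<and> (\<forall>n\<ge>1. \<pi> (a n) \<Omega> = 0)"

definition cuntz_cyclic_rep ::
  "(nat \<Rightarrow> 'o::cstar_algebra) \<Rightarrow> ('o \<Rightarrow> 'h::chilbert_space \<Rightarrow> 'h) \<Rightarrow> 'h \<Rightarrow> bool" where
  "cuntz_cyclic_rep t \<pi> \<Omega> \<longleftrightarrow>
     bounded_star_rep \<pi> \<and> closure (orbit \<pi> \<Omega>) = UNIV \<and> norm \<Omega> = 1 \<and> \<pi> (t 1) \<Omega> = \<Omega>"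


section \<open>Recursive boson and fermion systems\<close>

definition word_span ::
  "(nat \<Rightarrow> 'o::cstar_algebra) \<Rightarrow> ('o \<Rightarrow> 'h::chilbert_space \<Rightarrow> 'h) \<Rightarrow> 'h \<Rightarrow> 'h set" where
  "word_span t \<pi> \<Omega> = cspan {\<pi> (prod_list (map t is)) \<Omega> | is. is \<noteq> [] \<and> set is \<subseteq> {1,2}}"

definition cuntz_s :: "(nat \<Rightarrow> 'o::cstar_algebra) \<Rightarrow> nat \<Rightarrow> 'o" where
  "cuntz_s t m = t 2 ^ (m - 1) * t 1"

definition rho ::
  "(nat \<Rightarrow> 'o::cstar_algebra) \<Rightarrow> ('o \<Rightarrow> 'h::chilbert_space \<Rightarrow> 'h) \<Rightarrow> ('h \<Rightarrow> 'h) \<Rightarrow> 'h \<Rightarrow> 'h" where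
  "rho t \<pi> X v = (\<Sum>\<^sub>\<infinity>m\<in>{1..}. \<pi> (cuntz_s t m) (X (\<pi> (star (cuntz_s t m)) v)))"

definition rbs_one ::
  "(nat \<Rightarrow> 'o::cstar_algebra) \<Rightarrow> ('o \<Rightarrow> 'h::chilbert_space \<Rightarrow> 'h) \<Rightarrow> 'h \<Rightarrow> 'h" where
  "rbs_one t \<pi> v =
     (\<Sum>\<^sub>\<infinity>m\<in>{1..}. sqrt (real m) *\<^sub>R \<pi> (cuntz_s t m) (\<pi> (star (cuntz_s t (m + 1))) v))"

definition rbs ::
  "(nat \<Rightarrow> 'o::cstar_algebra) \<Rightarrow> ('o \<Rightarrow> 'h::chilbert_space \<Rightarrow> 'h) \<Rightarrow> nat \<Rightarrow> 'h \<Rightarrow> 'h" where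
  "rbs t \<pi> n = (rho t \<pi> ^^ (n - 1)) (rbs_one t \<pi>)"

definition zeta ::
  "(nat \<Rightarrow> 'o::cstar_algebra) \<Rightarrow> ('o \<Rightarrow> 'h::chilbert_space \<Rightarrow> 'h) \<Rightarrow> ('h \<Rightarrow> 'h) \<Rightarrow> 'h \<Rightarrow> 'h" where
  "zeta t \<pi> Y v = \<pi> (t 1) (Y (\<pi> (star (t 1)) v)) - \<pi> (t 2) (Y (\<pi> (star (t 2)) v))"

definition rfs ::
  "(nat \<Rightarrow> 'o::cstar_algebra) \<Rightarrow> ('o \<Rightarrow> 'h::chilbert_space \<Rightarrow> 'h) \<Rightarrow> nat \<Rightarrow> 'h \<Rightarrow> 'h" where
  "rfs t \<pi> n = (zeta t \<pi> ^^ (n - 1)) (\<lambda>v. \<pi> (t 1) (\<pi> (star (t 2)) v))"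

text \<open>The operators of the adjoint generators are determined by \<open>star_rep\<close>.\<close>

definition rbs_rep ::
  "(nat \<Rightarrow> 'o::cstar_algebra) \<Rightarrow> ('o \<Rightarrow> 'h::chilbert_space \<Rightarrow> 'h) \<Rightarrow> 'h \<Rightarrow>
   (nat \<Rightarrow> 'b::star_algebra) \<Rightarrow> ('b \<Rightarrow> 'h \<Rightarrow> 'h) \<Rightarrow> bool" where
  "rbs_rep t \<pi> \<Omega> b \<pi>RBS \<longleftrightarrow>
     star_rep (word_span t \<pi> \<Omega>) \<pi>RBS \<and>
     (\<forall>n\<ge>1. \<forall>v\<in>word_span t \<pi> \<Omega>. \<pi>RBS (b n) v = rbs t \<pi> n v)"

definition rfs_rep ::
  "(nat \<Rightarrow> 'o::cstar_algebra) \<Rightarrow> ('o \<Rightarrow> 'h::chilbert_space \<Rightarrow> 'h) \<Rightarrow>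
   (nat \<Rightarrow> 'a::star_algebra) \<Rightarrow> ('a \<Rightarrow> 'h \<Rightarrow> 'h) \<Rightarrow> bool" where
  "rfs_rep t \<pi> a \<pi>RFS \<longleftrightarrow>
     bounded_star_rep \<pi>RFS \<and> (\<forall>n\<ge>1. \<forall>v. \<pi>RFS (a n) v = rfs t \<pi> n v)"

definition unitary :: "('h::chilbert_space \<Rightarrow> 'k::chilbert_space) \<Rightarrow> bool" where
  "unitary V \<longleftrightarrow>
     (\<forall>x y. V (x + y) = V x + V y) \<and> (\<forall>c x. V (c *\<^sub>C x) = c *\<^sub>C V x) \<and>
     (\<forall>x y. cinner (V x) (V y) = cinner x y) \<and> surj V"

definition unitary_equiv_on ::
  "('h::chilbert_space \<Rightarrow> 'k::chilbert_space) \<Rightarrow> 'h set \<Rightarrow> ('x::star_algebra \<Rightarrow> 'h \<Rightarrow> 'h) \<Rightarrow>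
   'k set \<Rightarrow> ('x \<Rightarrow> 'k \<Rightarrow> 'k) \<Rightarrow> bool" where
  "unitary_equiv_on V D \<pi> E \<sigma> \<longleftrightarrow>
     unitary V \<and> V ` D = E \<and> (\<forall>x. \<forall>w\<in>E. V (\<pi> x (inv V w)) = \<sigma> x w)"


section \<open>Monomials\<close>

text \<open>\<open>[(n\<^sub>1, k\<^sub>1), \<dots>, (n\<^sub>m, k\<^sub>m)]\<close> stands for the indices and exponents in
  \<open>(b\<^bsub>n\<^sub>1\<^esub>\<^sup>*)^k\<^sub>1 \<cdots> (b\<^bsub>n\<^sub>m\<^esub>\<^sup>*)^k\<^sub>m\<close>.\<close>

definition boson_indices :: "(nat \<times> nat) list set" where
  "boson_indices = {nks. nks \<noteq> [] \<and> sorted_wrt (<) (map fst nks) \<and>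
                         (\<forall>(n, k) \<in> set nks. 1 \<le> n \<and> 1 \<le> k)}"

definition boson_monomial :: "(nat \<Rightarrow> 'b::star_algebra) \<Rightarrow> (nat \<times> nat) list \<Rightarrow> 'b" where
  "boson_monomial b nks = prod_list (map (\<lambda>(n, k). star (b n) ^ k) nks)"

definition fermion_indices :: "nat list set" where
  "fermion_indices = {js. js \<noteq> [] \<and> sorted_wrt (<) js \<and> (\<forall>j \<in> set js. 1 \<le> j)}"

definition fermion_monomial :: "(nat \<Rightarrow> 'a::star_algebra) \<Rightarrow> nat list \<Rightarrow> 'a" where
  "fermion_monomial a js = prod_list (map (\<lambda>j. star (a j)) js)"

definition A_block :: "(nat \<Rightarrow> 'a::star_algebra) \<Rightarrow> nat \<Rightarrow> nat \<Rightarrow> 'a" where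
  "A_block a n m = prod_list (map (\<lambda>i. star (a (n + i))) [1..<m + 1])"

definition corresponding_monomial :: "(nat \<Rightarrow> 'a::star_algebra) \<Rightarrow> (nat \<times> nat) list \<Rightarrow> 'a" where
  "corresponding_monomial a nks =
     prod_list (map (\<lambda>i. A_block a (fst (nks ! i) + (\<Sum>l<i. snd (nks ! l)) - 1) (snd (nks ! i)))
                    [0..<length nks])"

end

theory Submission
  imports Defs
begin

text \<open>
  Both monomials produce, up to a positive factor, the same vector of the representation space of
  the Cuntz algebra: a word in \<open>t\<^sub>1, t\<^sub>2\<close> applied to \<open>\<Omega>\<close>. Because \<open>\<Omega> = t\<^sub>1 \<Omega>\<close>, such a word is an infinite
  sequence of letters that ends in 1s, and it can be read in two ways.

  For the fermions, the letter 2 in position \<open>j\<close> means that the mode \<open>j\<close> is occupied: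
  \<open>a\<^sub>j\<^sup>*\<close> turns the letter 1 in position \<open>j\<close> into a 2, with a sign for each 2 to the left of it. In a
  monomial with increasing indices the operators with large indices act first, so each of them finds
  only 1s to its left, and no sign appears (\<open>fermion_monomial_vac\<close>).

  For the bosons, the word is cut after each letter 1 into factors \<open>t\<^sub>2\<^sup>m t\<^sub>1\<close>, and the exponent in the
  \<open>n\<close>-th factor is the occupation number of the mode \<open>n\<close>: \<open>b\<^sub>n\<^sup>*\<close> inserts one more 2 into the \<open>n\<close>-th
  factor and multiplies by the square root of the new occupation number (\<open>boson_creation\<close>). A boson
  monomial therefore yields the word with \<open>k\<^sub>i\<close> letters 2 in the factor \<open>n\<^sub>i\<close>, times the product of
  the \<open>sqrt (k\<^sub>i!)\<close> (\<open>boson_monomial_vac\<close>).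

  The 2s in the factor \<open>n\<^sub>i\<close> are preceded by \<open>n\<^sub>i - 1\<close> letters 1 and by the \<open>k\<^sub>1 + \<dots> + k\<^bsub>i-1\<^esub>\<close> letters 2
  of the earlier factors. They are a run of \<open>k\<^sub>i\<close> positions from \<open>n\<^sub>i + k\<^sub>1 + \<dots> + k\<^bsub>i-1\<^esub>\<close> on, which are
  the indices in the corresponding block of fermions. That the map of index lists is a bijection
  (\<open>bij_betw_spread\<close>) says that a finite set of positions decomposes uniquely into maximal runs.
  Finally, different words give different unit vectors (\<open>config_inject\<close>), so the monomials
  themselves are determined by their indices.
\<close>

section \<open>Inner products\<close>

lemma cinner_zero_right [simp]: "cinner x 0 = 0"
  using cinner_scaleC_right[of x 0 0] by simp

lemma cinner_diff_right: "cinner x (y - z) = cinner x y - cinner x z"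
  using cinner_add_right[of x "y - z" z] by simp

lemma cinner_zero_left [simp]: "cinner 0 x = 0"
  using cinner_commute[of 0 x] by simp

lemma cinner_add_left: "cinner (x + y) z = cinner x z + cinner y z"
  using cinner_commute[of "x + y" z] cinner_commute[of x z] cinner_commute[of y z]
  by (simp add: cinner_add_right)

lemma cinner_diff_left: "cinner (x - y) z = cinner x z - cinner y z"
  using cinner_add_left[of "x - y" y z] by simp

lemma cinner_scaleC_left: "cinner (c *\<^sub>C x) y = cnj c * cinner x y"
  using cinner_commute[of "c *\<^sub>C x" y] cinner_commute[of x y]
  by (simp add: cinner_scaleC_right)

lemma cinner_scaleR_left: "cinner (r *\<^sub>R x) y = of_real r * cinner x y"
  by (simp add: scaleR_scaleC cinner_scaleC_left)

lemma cinner_scaleR_right: "cinner x (r *\<^sub>R y) = of_real r * cinner x y"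
  by (simp add: scaleR_scaleC cinner_scaleC_right)

lemma cinner_self_eq_0D: "cinner x x = 0 \<Longrightarrow> x = 0"
  using norm_eq_sqrt_cinner[of x] by simp

lemma cinner_left_ext: "(\<And>u. cinner u x = cinner u y) \<Longrightarrow> x = y"
  using cinner_self_eq_0D[of "x - y"] by (simp add: cinner_diff_right)


section \<open>Star-representations and unitaries\<close>

lemma star_rep_zero: "star_rep D \<pi> \<Longrightarrow> \<pi> x 0 = 0"
proof -
  assume r: "star_rep D \<pi>"
  then have "0 \<in> D" by (simp add: star_rep_def complex_vector.subspace_0)
  then have "\<pi> x (0 *\<^sub>C 0) = 0 *\<^sub>C \<pi> x 0" using r by (simp only: star_rep_def)
  then show ?thesis by simp
qed

lemma star_rep_scaleR: "star_rep D \<pi> \<Longrightarrow> u \<in> D \<Longrightarrow> \<pi> x (r *\<^sub>R u) = r *\<^sub>R \<pi> x u"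
  by (simp add: star_rep_def scaleR_scaleC)

lemma star_rep_of_zero: "star_rep D \<pi> \<Longrightarrow> u \<in> D \<Longrightarrow> \<pi> 0 u = 0"
proof -
  assume r: "star_rep D \<pi>" and u: "u \<in> D"
  then have "\<pi> (0 *\<^sub>C 0) u = 0 *\<^sub>C \<pi> 0 u" by (simp only: star_rep_def)
  then show ?thesis by simp
qed

lemma unitary_inv: "unitary V \<Longrightarrow> inv V (V x) = x"
proof -
  assume V: "unitary V"
  have "inj V"
  proof (rule injI)
    fix x y assume "V x = V y"
    then have "cinner u x = cinner u y" for u using V by (metis unitary_def)
    then show "x = y" by (rule cinner_left_ext)
  qed
  then show ?thesis by simp
qed

lemma unitary_equiv_on_apply:
  assumes "unitary_equiv_on V D \<pi> E \<sigma>" and "V v \<in> E"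
  shows "\<sigma> x (V v) = V (\<pi> x v)"
  using assms unitary_inv[of V v] unfolding unitary_equiv_on_def by metis


section \<open>Spreading occupation numbers into occupied positions\<close>

text \<open>Positions of the 2s in the word whose \<open>n\<close>-th factor is \<open>t\<^sub>2\<^sup>k t\<^sub>1\<close> for each \<open>(n, k)\<close> in the list and
  whose other factors are \<open>t\<^sub>1\<close>. The offset \<open>K\<close> is the number of 2s in the earlier factors.\<close>

primrec spread :: "nat \<Rightarrow> (nat \<times> nat) list \<Rightarrow> nat list" where
  "spread K [] = []"
| "spread K (nk # nks) = [fst nk + K..<fst nk + K + snd nk] @ spread (K + snd nk) nks"

lemma spread_greater:
  "\<forall>(n, k) \<in> set nks. d < n \<Longrightarrow> j \<in> set (spread K nks) \<Longrightarrow> d + K < j"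
proof (induction nks arbitrary: K)
  case (Cons nk nks)
  then show ?case using Cons.IH[of "K + snd nk"] by (cases nk) fastforce
qed simp

lemma sorted_spread:
  "sorted_wrt (<) (map fst nks) \<Longrightarrow> sorted_wrt (<) (spread K nks)"
proof (induction nks arbitrary: K)
  case (Cons nk nks)
  have "\<forall>(n, k) \<in> set nks. fst nk < n" using Cons.prems by auto
  then have "fst nk + (K + snd nk) < j" if "j \<in> set (spread (K + snd nk) nks)" for j
    using that by (rule spread_greater)
  then show ?case using Cons by (fastforce simp: sorted_wrt_append)
qed simp

text \<open>The entries of the list are recovered from the left: the first position gives the mode, and the
  run that starts there ends exactly where the occupation number is exhausted, because the next mode
  is strictly larger and so at least one position is skipped.\<close>

lemma spread_inject:
  "\<lbrakk>spread K nks = spread K nks';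
    sorted_wrt (<) (map fst nks); \<forall>(n, k) \<in> set nks. 1 \<le> k;
    sorted_wrt (<) (map fst nks'); \<forall>(n, k) \<in> set nks'. 1 \<le> k\<rbrakk> \<Longrightarrow> nks = nks'"
proof (induction nks arbitrary: K nks')
  case Nil
  then show ?case by (cases nks') auto
next
  case (Cons x nks)
  obtain n k where x: "x = (n, k)" by (cases x)
  from Cons.prems x obtain n' k' nks'' where nks': "nks' = (n', k') # nks''"
    by (cases nks') auto
  have k: "1 \<le> k" "1 \<le> k'" using Cons.prems x nks' by auto
  have n: "n = n'" using Cons.prems(1) k by (simp add: x nks' upt_conv_Cons)
  \<comment> \<open>\<open>k\<close> and \<open>k'\<close> are both the least \<open>i\<close> such that the position \<open>n + K + i\<close> is free.\<close>
  have run_end: "m + K + l \<notin> set (spread K ((m, l) # ms))"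
    if "sorted_wrt (<) (map fst ((m, l) # ms))" for m l ms
    using that spread_greater[of ms m _ "K + l"] by fastforce
  have run: "m + K + i \<in> set (spread K ((m, l) # ms))" if "i < l" for m l i ms
    using that by simp
  have "k = k'"
    using run_end[of n k nks] run_end[of n k' nks''] run[of k k' n nks''] run[of k' k n nks]
      Cons.prems x nks' n by (metis linorder_neqE_nat)
  then show ?case using Cons x nks' n by auto
qed

text \<open>A sorted list of positions is built up from its end. A new first position either extends
  the run that follows it by one, or opens a run of length one.\<close>

lemma spread_surj:
  "sorted_wrt (<) js \<Longrightarrow> \<forall>j\<in>set js. d + K < j \<Longrightarrow>
   \<exists>nks. sorted_wrt (<) (map fst nks) \<and> (\<forall>(n, k) \<in> set nks. d < n \<and> 1 \<le> k) \<and> spread K nks = js"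
proof (induction js arbitrary: d K)
  case Nil
  show ?case by (rule exI[of _ "[]"]) simp
next
  case (Cons j js)
  have j: "d + K < j" using Cons.prems by simp
  \<comment> \<open>Position \<open>j\<close> is one more 2 before the rest. The mode \<open>j - K\<close> itself is allowed there, for the
    case that the run goes on.\<close>
  have "\<forall>i\<in>set js. (j - K - 1) + (K + 1) < i" using Cons.prems j by auto
  with Cons obtain nks where
    nks: "sorted_wrt (<) (map fst nks)" "\<forall>(n, k) \<in> set nks. j - K - 1 < n \<and> 1 \<le> k"
      "spread (K + 1) nks = js" by (metis sorted_wrt.simps(2))
  show ?case
  proof (cases "\<exists>k ms. nks = (j - K, k) # ms")
    case True
    then obtain k ms where [simp]: "nks = (j - K, k) # ms" by blast
    have "spread K ((j - K, Suc k) # ms) = j # js"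
      using nks(3) j by (auto simp: upt_conv_Cons)
    moreover have "\<forall>(n, k) \<in> set ((j - K, Suc k) # ms). d < n \<and> 1 \<le> k"
      using nks j by fastforce
    ultimately show ?thesis using nks(1) by (intro exI[of _ "(j - K, Suc k) # ms"]) auto
  next
    case False
    have gt: "j - K < n" if "(n, k) \<in> set nks" for n k
    proof (cases nks)
      case (Cons p ms)
      have "j - K < fst p"
        using False nks(2) Cons by (cases p) (fastforce intro!: le_neq_implies_less)
      then show ?thesis using that nks(1) Cons by fastforce
    qed (use that in simp)
    have "spread K ((j - K, 1) # nks) = j # js" using nks(3) j by auto
    moreover have "\<forall>(n, k) \<in> set ((j - K, 1) # nks). d < n \<and> 1 \<le> k"
      using nks j by fastforce
    ultimately show ?thesis using nks(1) gt
      by (intro exI[of _ "(j - K, 1) # nks"]) auto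
  qed
qed

lemma bij_betw_spread: "bij_betw (spread 0) boson_indices fermion_indices"
  unfolding bij_betw_def
proof (intro conjI equalityI subsetI)
  show "inj_on (spread 0) boson_indices"
    by (rule inj_onI, rule spread_inject) (auto simp: boson_indices_def)
next
  fix js assume "js \<in> spread 0 ` boson_indices"
  then obtain nks where js: "js = spread 0 nks" and nks: "nks \<in> boson_indices" by blast
  have "js \<noteq> []" using nks by (cases nks) (auto simp: js boson_indices_def)
  moreover have "0 + 0 < j" if "j \<in> set js" for j
    by (rule spread_greater[of nks]) (use nks that in \<open>auto simp: js boson_indices_def\<close>)
  ultimately show "js \<in> fermion_indices"
    using nks sorted_spread[of nks] by (auto simp: fermion_indices_def boson_indices_def js Suc_le_eq)
next
  fix js assume js: "js \<in> fermion_indices"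
  then have "\<forall>j\<in>set js. 0 + 0 < j" by (auto simp: fermion_indices_def)
  with js obtain nks where nks: "sorted_wrt (<) (map fst nks)"
      "\<forall>(n, k) \<in> set nks. 0 < n \<and> 1 \<le> k" "spread 0 nks = js"
    using spread_surj[of js 0 0] by (auto simp: fermion_indices_def)
  have "nks \<noteq> []" using js nks(3) by (auto simp: fermion_indices_def)
  then have "nks \<in> boson_indices" using nks(1,2) by (auto simp: boson_indices_def)
  then show "js \<in> spread 0 ` boson_indices" using nks(3) by blast
qed

lemma A_block_eq: "A_block a m k = fermion_monomial a [Suc m..<Suc m + k]"
proof -
  have "map (\<lambda>i. m + i) [1..<k + 1] = [Suc m..<Suc m + k]"
    by (induction k) simp_all
  from this[symmetric] show ?thesis
    by (simp only: A_block_def fermion_monomial_def map_map comp_def)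
qed

lemma fermion_monomial_append:
  "fermion_monomial a (js @ js') = fermion_monomial a js * fermion_monomial a js'"
  by (simp add: fermion_monomial_def)

text \<open>The offset \<open>K\<close> stands for the sum of the exponents of an initial part of the monomial, which the
  induction has split off.\<close>

lemma prod_blocks_spread:
  "\<forall>(n, k) \<in> set nks. 1 \<le> n \<Longrightarrow>
   prod_list (map (\<lambda>i. A_block a (fst (nks ! i) + (K + (\<Sum>l<i. snd (nks ! l))) - 1) (snd (nks ! i)))
                  [0..<length nks]) = fermion_monomial a (spread K nks)"
proof (induction nks arbitrary: K)
  case Nil
  show ?case by (simp add: fermion_monomial_def)
next
  case (Cons nk nks)
  have "1 \<le> fst nk" using Cons.prems by auto
  moreover have "[0..<length (nk # nks)] = 0 # map Suc [0..<length nks]"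
    by (simp add: map_Suc_upt upt_conv_Cons del: upt_Suc)
  ultimately show ?case
    using Cons.IH[of "K + snd nk"] Cons.prems
    by (simp add: comp_def sum.lessThan_Suc_shift A_block_eq fermion_monomial_append add.assoc
        del: upt_Suc sum.lessThan_Suc)
qed

lemma corresponding_monomial_eq:
  "nks \<in> boson_indices \<Longrightarrow> corresponding_monomial a nks = fermion_monomial a (spread 0 nks)"
  using prod_blocks_spread[of nks a 0]
  by (auto simp: corresponding_monomial_def boson_indices_def)


section \<open>The vacuum representation of the Cuntz algebra\<close>

text \<open>This keeps the index of the generator \<open>t 1\<close> in the form in which the relations state it,
  instead of \<open>Suc 0\<close>.\<close>

declare One_nat_def [simp del]

locale cuntz_vacuum =
  fixes t :: "nat \<Rightarrow> 'o::cstar_algebra"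
    and \<pi> :: "'o \<Rightarrow> 'h::chilbert_space \<Rightarrow> 'h" and \<Omega> :: 'h
  assumes gens: "cuntz_generators t" and vacuum: "cuntz_cyclic_rep t \<pi> \<Omega>"
begin

abbreviation "T1 \<equiv> \<pi> (t 1)"
abbreviation "T2 \<equiv> \<pi> (t 2)"

text \<open>With the shift \<open>S m = \<pi> (cuntz_s t (Suc m))\<close>, the index \<open>m\<close> is a boson occupation number.\<close>

abbreviation "S m \<equiv> \<pi> (t 2 ^ m * t 1)"

abbreviation "D \<equiv> word_span t \<pi> \<Omega>"

lemma rep: "star_rep UNIV \<pi>"
  using vacuum by (simp add: cuntz_cyclic_rep_def bounded_star_rep_def)

lemma op_add: "\<pi> x (u + v) = \<pi> x u + \<pi> x v"
  and op_scaleC: "\<pi> x (c *\<^sub>C u) = c *\<^sub>C \<pi> x u"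
  and op_one [simp]: "\<pi> 1 u = u"
  and op_mult: "\<pi> (x * y) u = \<pi> x (\<pi> y u)"
  and op_adj: "cinner (\<pi> x u) v = cinner u (\<pi> (star x) v)"
  using rep by (simp_all add: star_rep_def)

lemma op_adj': "cinner u (\<pi> x v) = cinner (\<pi> (star x) u) v"
  using op_adj[of "star x" u v] by (simp add: star_star)

lemma op_zero [simp]: "\<pi> x 0 = 0"
  using rep by (rule star_rep_zero)

lemma zero_op [simp]: "\<pi> 0 v = 0"
  using rep by (rule star_rep_of_zero) simp

lemma op_scaleR: "\<pi> x (r *\<^sub>R u) = r *\<^sub>R \<pi> x u"
  using rep by (rule star_rep_scaleR) simp

lemma T1_vac [simp]: "T1 \<Omega> = \<Omega>" and norm_vac: "norm \<Omega> = 1"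
  using vacuum by (simp_all add: cuntz_cyclic_rep_def)

lemma T1_funpow_vac [simp]: "(T1 ^^ n) \<Omega> = \<Omega>"
  by (induction n) auto

lemma gen_orth:
  "star (t 1) * t 1 = 1" "star (t 2) * t 2 = 1" "star (t 1) * t 2 = 0" "star (t 2) * t 1 = 0"
  using gens by (simp_all add: cuntz_generators_def)

lemma adj_T [simp]:
  "\<pi> (star (t 1)) (T1 v) = v" "\<pi> (star (t 2)) (T2 v) = v"
  "\<pi> (star (t 1)) (T2 v) = 0" "\<pi> (star (t 2)) (T1 v) = 0"
  by (simp_all add: op_mult[symmetric] gen_orth)

lemma norm_T: "norm (T1 v) = norm v" "norm (T2 v) = norm v"
  by (simp_all add: norm_eq_sqrt_cinner op_adj)

lemma norm_T1_funpow: "norm ((T1 ^^ n) v) = norm v"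
  by (induction n) (auto simp: norm_T)

lemma S_orth: "star (t 2 ^ m * t 1) * (t 2 ^ k * t 1) = (if m = k then 1 else 0)"
proof (induction m arbitrary: k)
  case 0
  show ?case by (cases k) (simp_all add: gen_orth mult.assoc[symmetric])
next
  case (Suc m)
  have "star (t 2 ^ Suc m * t 1) = star (t 2 ^ m * t 1) * star (t 2)"
    by (simp add: mult.assoc star_mult)
  then show ?case using Suc[of "k - 1"]
    by (cases k) (simp_all add: gen_orth mult.assoc,
      metis gen_orth(2) mult.assoc mult_1_left)
qed

lemma adj_S [simp]: "\<pi> (star (t 2 ^ m * t 1)) (S k v) = (if m = k then v else 0)"
  by (simp add: op_mult[symmetric] S_orth)

lemma cinner_S: "cinner (S m u) (S k v) = (if m = k then cinner u v else 0)"
  by (simp add: op_adj)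

lemma S_0: "S 0 v = T1 v"
  by simp

lemma S_eq: "S m v = (T2 ^^ m) (T1 v)"
  by (induction m) (simp_all add: op_mult)


subsection \<open>The span of the words\<close>

lemma D_word: "is \<noteq> [] \<Longrightarrow> set is \<subseteq> {1, 2} \<Longrightarrow> \<pi> (prod_list (map t is)) \<Omega> \<in> D"
  unfolding word_span_def by (rule complex_vector.span_base) blast

lemma D_vac: "\<Omega> \<in> D"
  using D_word[of "[1]"] by simp

lemma D_subspace: "csubspace D"
  unfolding word_span_def by (rule complex_vector.subspace_span)

lemma D_scaleR: "v \<in> D \<Longrightarrow> r *\<^sub>R v \<in> D"
  unfolding scaleR_scaleC using D_subspace by (rule complex_vector.subspace_scale)

lemma D_gen:
  assumes "i \<in> {1, 2}" and "v \<in> D"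
  shows "\<pi> (t i) v \<in> D"
  using assms(2) unfolding word_span_def
proof (rule complex_vector.span_induct)
  show "csubspace {v. \<pi> (t i) v \<in> cspan {\<pi> (prod_list (map t is)) \<Omega> |is. is \<noteq> [] \<and> set is \<subseteq> {1, 2}}}"
    by (auto simp: complex_vector.subspace_def op_add op_scaleC complex_vector.span_zero
        intro: complex_vector.span_add complex_vector.span_scale)
next
  fix v assume "v \<in> {\<pi> (prod_list (map t is)) \<Omega> |is. is \<noteq> [] \<and> set is \<subseteq> {1, 2}}"
  then obtain "is" where "set is \<subseteq> {1, 2}" "v = \<pi> (prod_list (map t is)) \<Omega>" by blast
  then show "\<pi> (t i) v \<in> cspan {\<pi> (prod_list (map t is)) \<Omega> |is. is \<noteq> [] \<and> set is \<subseteq> {1, 2}}"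
    using D_word[of "i # is"] assms(1) by (simp add: op_mult word_span_def)
qed

lemma D_T1_funpow: "v \<in> D \<Longrightarrow> (T1 ^^ n) v \<in> D"
  by (induction n) (auto simp: D_gen)

lemma D_S: "v \<in> D \<Longrightarrow> S m v \<in> D"
  by (induction m) (auto simp: op_mult D_gen)

text \<open>Since \<open>\<Omega> = T1 \<Omega>\<close>, every word acting on the vacuum can be assumed to contain a 1. Cutting
  it after its first 1 exhibits a factor \<open>S m\<close>.\<close>

lemma word_eq_S:
  "is \<noteq> [] \<Longrightarrow> set is \<subseteq> {1, 2} \<Longrightarrow> \<exists>m. \<exists>u\<in>D. \<pi> (prod_list (map t is)) \<Omega> = S m u"
proof (induction "is")
  case (Cons i "is")
  have w: "\<pi> (prod_list (map t is)) \<Omega> \<in> D"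
    using Cons.prems D_word[of "is"] D_vac by (cases "is = []") auto
  consider "i = 1" | "i = 2" "is = []" | "i = 2" "is \<noteq> []" using Cons.prems by auto
  then show ?case
  proof cases
    case 1
    then show ?thesis using w by (intro exI[of _ 0] bexI[of _ "\<pi> (prod_list (map t is)) \<Omega>"])
        (simp_all add: op_mult)
  next
    case 2
    then show ?thesis using D_vac
      by (intro exI[of _ 1] bexI[of _ \<Omega>]) (simp_all add: op_mult)
  next
    case 3
    then obtain m u where "u \<in> D" "\<pi> (prod_list (map t is)) \<Omega> = S m u"
      using Cons by auto
    then show ?thesis using 3 by (intro exI[of _ "Suc m"] bexI[of _ u]) (simp_all add: op_mult)
  qed
qed simp

text \<open>The way to identify vectors that are known only through adjoints: \<open>x - y\<close> lies in \<open>D\<close> itself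
  and is orthogonal to the words that span \<open>D\<close>, hence to itself.\<close>

lemma D_ext:
  assumes "x \<in> D" and "y \<in> D" and eq: "\<And>m u. u \<in> D \<Longrightarrow> cinner (S m u) x = cinner (S m u) y"
  shows "x = y"
proof -
  have "x - y \<in> D" using assms(1,2) D_subspace by (blast intro: complex_vector.subspace_diff)
  then have "cinner (x - y) (x - y) = 0"
    unfolding word_span_def
  proof (rule complex_vector.span_induct[where P = "\<lambda>v. cinner v (x - y) = 0"])
    show "csubspace {v. cinner v (x - y) = 0}"
      by (simp add: complex_vector.subspace_def cinner_add_left cinner_scaleC_left)
  next
    fix v assume "v \<in> {\<pi> (prod_list (map t is)) \<Omega> |is. is \<noteq> [] \<and> set is \<subseteq> {1, 2}}"
    then obtain m u where "u \<in> D" "v = S m u" using word_eq_S by blast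
    then show "cinner v (x - y) = 0" using eq by (simp add: cinner_diff_right)
  qed
  then show ?thesis using cinner_self_eq_0D by fastforce
qed


subsection \<open>Configuration vectors\<close>

text \<open>The part after position \<open>d\<close> of the word that has its 2s exactly in the positions \<open>js\<close>, applied
  to the vacuum, when \<open>js\<close> is increasing and all its elements exceed \<open>d\<close>.\<close>

primrec config :: "nat \<Rightarrow> nat list \<Rightarrow> 'h" where
  "config d [] = \<Omega>"
| "config d (j # js) = (T1 ^^ (j - Suc d)) (T2 (config j js))"

lemma norm_config: "norm (config d js) = 1"
  by (induction js arbitrary: d)
    (simp_all add: norm_vac norm_T1_funpow norm_T)

lemma D_config: "config d js \<in> D"
  by (induction js arbitrary: d) (simp_all add: D_vac D_T1_funpow D_gen)

lemma config_shift:
  assumes "d \<le> e" and "\<forall>j\<in>set js. e < j"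
  shows "(T1 ^^ (e - d)) (config e js) = config d js"
proof (cases js)
  case (Cons j js')
  then have "j - Suc d = (e - d) + (j - Suc e)" using assms by auto
  then show ?thesis by (simp add: Cons funpow_add)
qed simp

lemma config_run: "config d ([Suc d..<Suc d + k] @ js) = (T2 ^^ k) (config (d + k) js)"
proof (induction k arbitrary: d)
  case (Suc k)
  have "[Suc d..<Suc d + Suc k] = Suc d # [Suc (Suc d)..<Suc (Suc d) + k]"
    by (simp add: upt_conv_Cons)
  then show ?case using Suc[of "Suc d"] by (simp del: upt_Suc)
qed simp

lemma T1_funpow_inject: "(T1 ^^ n) u = (T1 ^^ n) v \<Longrightarrow> u = v"
  by (induction n) (auto dest: arg_cong[where f = "\<pi> (star (t 1))"] simp: adj_T)

text \<open>The ranges of the two isometries are orthogonal.\<close>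

lemma T2_eq_T1D: "T2 u = T1 v \<Longrightarrow> norm u = 0"
  by (metis adj_T(2,4) norm_zero)

lemma config_first_neq:
  assumes "j < j'" and "d < j"
  shows "config d (j # js) \<noteq> config d (j' # js')"
proof
  assume "config d (j # js) = config d (j' # js')"
  moreover have "j' - Suc d = (j - Suc d) + Suc (j' - Suc j)" using assms by simp
  then have "(T1 ^^ (j' - Suc d)) w = (T1 ^^ (j - Suc d)) (T1 ((T1 ^^ (j' - Suc j)) w))" for w
    by (simp only: funpow_add comp_apply funpow.simps)
  ultimately have "(T1 ^^ (j - Suc d)) (T2 (config j js)) =
      (T1 ^^ (j - Suc d)) (T1 ((T1 ^^ (j' - Suc j)) (T2 (config j' js'))))"
    by (simp only: config.simps)
  then have "T2 (config j js) = T1 ((T1 ^^ (j' - Suc j)) (T2 (config j' js')))"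
    by (rule T1_funpow_inject)
  then show False using T2_eq_T1D norm_config by (metis zero_neq_one)
qed

lemma config_neq_vac: "config d (j # js) \<noteq> \<Omega>"
proof
  assume "config d (j # js) = \<Omega>"
  then have "(T1 ^^ (j - Suc d)) (T2 (config j js)) = (T1 ^^ (j - Suc d)) (T1 \<Omega>)"
    by simp
  then have "T2 (config j js) = T1 \<Omega>" by (rule T1_funpow_inject)
  then show False using T2_eq_T1D norm_config by (metis zero_neq_one)
qed

text \<open>At the first position where two words differ, one vector lies in the range of \<open>T1\<close> and the other
  in that of \<open>T2\<close>.\<close>

lemma config_inject:
  "\<lbrakk>config d js = config d js'; sorted_wrt (<) js; \<forall>j\<in>set js. d < j;
    sorted_wrt (<) js'; \<forall>j\<in>set js'. d < j\<rbrakk> \<Longrightarrow> js = js'"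
proof (induction js arbitrary: d js')
  case Nil
  then show ?case using config_neq_vac by (cases js') (auto dest: sym)
next
  case (Cons j js)
  then obtain j' js'' where js': "js' = j' # js''"
    using config_neq_vac by (cases js') auto
  have j: "j = j'"
    using Cons.prems config_first_neq[of j j' d js js''] config_first_neq[of j' j d js'' js]
    unfolding js' by (metis linorder_neqE_nat list.set_intros(1))
  have "T2 (config j js) = T2 (config j js'')"
    using Cons.prems(1) T1_funpow_inject unfolding js' j by simp
  then have "config j js = config j js''"
    using adj_T(2) by metis
  then show ?case using Cons.IH[of j js''] Cons.prems by (simp add: js' j)
qed

end


section \<open>Fermion monomials on the vacuum\<close>

locale fermion_system = cuntz_vacuum t \<pi> \<Omega>
  for t :: "nat \<Rightarrow> 'o::cstar_algebra" and \<pi> :: "'o \<Rightarrow> 'h::chilbert_space \<Rightarrow> 'h" and \<Omega> :: 'h +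
  fixes a :: "nat \<Rightarrow> 'a::star_algebra" and \<alpha> :: "'a \<Rightarrow> 'h \<Rightarrow> 'h"
  assumes rfs: "rfs_rep t \<pi> a \<alpha>"
begin

lemma fermion_rep: "star_rep UNIV \<alpha>"
  using rfs by (simp add: rfs_rep_def bounded_star_rep_def)

lemma fermion_adj: "cinner u (\<alpha> (star (a (Suc n))) v) = cinner (rfs t \<pi> (Suc n) u) v"
proof -
  have "cinner (\<alpha> (a (Suc n)) u) v = cinner u (\<alpha> (star (a (Suc n))) v)"
    using fermion_rep by (simp add: star_rep_def)
  moreover have "\<alpha> (a (Suc n)) u = rfs t \<pi> (Suc n) u"
    using rfs by (simp add: rfs_rep_def One_nat_def)
  ultimately show ?thesis by simp
qed

lemma fermion_creation_1: "\<alpha> (star (a 1)) (T1 v) = T2 v"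
  by (rule cinner_left_ext)
    (use fermion_adj[of _ 0] in \<open>simp add: rfs_def op_adj star_star One_nat_def[symmetric]\<close>)

text \<open>Only the summand of \<open>zeta\<close> without a sign matters on the range of \<open>T1\<close>.\<close>

lemma fermion_creation_Suc:
  "\<alpha> (star (a (Suc (Suc n)))) (T1 v) = T1 (\<alpha> (star (a (Suc n))) v)"
proof (rule cinner_left_ext)
  fix u
  have "cinner u (\<alpha> (star (a (Suc (Suc n)))) (T1 v)) =
      cinner (zeta t \<pi> (rfs t \<pi> (Suc n)) u) (T1 v)"
    unfolding fermion_adj by (simp add: rfs_def)
  also have "\<dots> = cinner (rfs t \<pi> (Suc n) (\<pi> (star (t 1)) u)) v"
    using adj_T by (simp add: zeta_def cinner_diff_left op_adj)
  also have "\<dots> = cinner u (T1 (\<alpha> (star (a (Suc n))) v))"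
    unfolding op_adj' fermion_adj by simp
  finally show "cinner u (\<alpha> (star (a (Suc (Suc n)))) (T1 v)) =
      cinner u (T1 (\<alpha> (star (a (Suc n))) v))" .
qed

lemma fermion_creation: "\<alpha> (star (a (Suc n))) ((T1 ^^ Suc n) v) = (T1 ^^ n) (T2 v)"
proof (induction n)
  case 0
  show ?case using fermion_creation_1[of v] by (simp add: One_nat_def)
next
  case (Suc n)
  then show ?case
    using fermion_creation_Suc by simp
qed

lemma fermion_monomial_vac:
  "sorted_wrt (<) js \<Longrightarrow> \<forall>j\<in>set js. 0 < j \<Longrightarrow> \<alpha> (fermion_monomial a js) \<Omega> = config 0 js"
proof (induction js)
  case Nil
  show ?case using fermion_rep by (simp add: fermion_monomial_def star_rep_def)
next
  case (Cons j js)
  obtain i where j: "j = Suc i" using Cons.prems by (cases j) auto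
  have "\<alpha> (fermion_monomial a (j # js)) \<Omega> = \<alpha> (star (a j)) (\<alpha> (fermion_monomial a js) \<Omega>)"
    using fermion_rep by (simp add: fermion_monomial_def star_rep_def)
  also have "\<dots> = \<alpha> (star (a j)) ((T1 ^^ j) (config j js))"
    using Cons config_shift[of 0 j js] by simp
  also have "\<dots> = config 0 (j # js)"
    unfolding j fermion_creation by simp
  finally show ?case .
qed

lemma inj_fermion_monomial: "inj_on (fermion_monomial a) fermion_indices"
proof (rule inj_onI)
  fix js js'
  assume js: "js \<in> fermion_indices" "js' \<in> fermion_indices"
    and eq: "fermion_monomial a js = fermion_monomial a js'"
  have "config 0 js = config 0 js'"
    using js eq fermion_monomial_vac[of js] fermion_monomial_vac[of js']
    by (auto simp: fermion_indices_def Suc_le_eq One_nat_def)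
  then show "js = js'"
    using js by (intro config_inject) (auto simp: fermion_indices_def Suc_le_eq One_nat_def)
qed

end


section \<open>Boson monomials on the vacuum\<close>

lemma infsum_single:
  fixes f :: "'i \<Rightarrow> 'v::{comm_monoid_add, t2_space}"
  assumes "\<And>j. j \<in> A \<Longrightarrow> j \<noteq> i \<Longrightarrow> f j = 0"
  shows "infsum f A = (if i \<in> A then f i else 0)"
proof -
  have "infsum f A = infsum f (A \<inter> {i})"
    by (rule infsum_cong_neutral) (use assms in auto)
  then show ?thesis by auto
qed

locale boson_system = cuntz_vacuum t \<pi> \<Omega>
  for t :: "nat \<Rightarrow> 'o::cstar_algebra" and \<pi> :: "'o \<Rightarrow> 'h::chilbert_space \<Rightarrow> 'h" and \<Omega> :: 'h +
  fixes b :: "nat \<Rightarrow> 'b::star_algebra" and \<beta> :: "'b \<Rightarrow> 'h \<Rightarrow> 'h"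
  assumes rbs: "rbs_rep t \<pi> \<Omega> b \<beta>"
begin

lemma boson_rep: "star_rep D \<beta>"
  using rbs by (simp add: rbs_rep_def)

lemma boson_D: "v \<in> D \<Longrightarrow> \<beta> x v \<in> D"
  and boson_mult: "v \<in> D \<Longrightarrow> \<beta> (x * y) v = \<beta> x (\<beta> y v)"
  and boson_one: "v \<in> D \<Longrightarrow> \<beta> 1 v = v"
  using boson_rep by (simp_all add: star_rep_def)

lemma boson_scaleR: "v \<in> D \<Longrightarrow> \<beta> x (r *\<^sub>R v) = r *\<^sub>R \<beta> x v"
  using boson_rep by (rule star_rep_scaleR)

lemma boson_adj:
  assumes "u \<in> D" and "v \<in> D"
  shows "cinner u (\<beta> (star (b (Suc n))) v) = cinner (rbs t \<pi> (Suc n) u) v"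
proof -
  have "cinner (\<beta> (b (Suc n)) u) v = cinner u (\<beta> (star (b (Suc n))) v)"
    using boson_rep assms by (simp add: star_rep_def)
  moreover have "\<beta> (b (Suc n)) u = rbs t \<pi> (Suc n) u"
    using rbs assms by (simp add: rbs_rep_def One_nat_def)
  ultimately show ?thesis by simp
qed

lemma rbs_1_S: "rbs t \<pi> 1 (S k u) = sqrt (real k) *\<^sub>R S (k - 1) u"
proof -
  have "rbs_one t \<pi> (S k u) =
      (if k \<in> {1..} then sqrt (real k) *\<^sub>R \<pi> (cuntz_s t k) (\<pi> (star (cuntz_s t (k + 1))) (S k u)) else 0)"
    unfolding rbs_one_def
    by (rule infsum_single) (auto simp: cuntz_s_def)
  moreover have "\<pi> (star (cuntz_s t (k + 1))) (S k u) = u"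
    by (simp add: cuntz_s_def)
  ultimately show ?thesis
    by (cases k) (simp_all add: rbs_def cuntz_s_def One_nat_def del: power_Suc)
qed

lemma rbs_zero: "rbs t \<pi> (Suc n) 0 = 0"
  by (induction n) (simp_all add: rbs_def rbs_one_def rho_def)

lemma rbs_Suc_S: "rbs t \<pi> (Suc (Suc n)) (S k u) = S k (rbs t \<pi> (Suc n) u)"
proof -
  have "rbs t \<pi> (Suc (Suc n)) (S k u) = rho t \<pi> (rbs t \<pi> (Suc n)) (S k u)"
    by (simp add: rbs_def)
  also have "\<dots> = (if Suc k \<in> {1..} then
      \<pi> (cuntz_s t (Suc k)) (rbs t \<pi> (Suc n) (\<pi> (star (cuntz_s t (Suc k))) (S k u))) else 0)"
    unfolding rho_def
    by (rule infsum_single) (auto simp: cuntz_s_def rbs_zero)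
  finally show ?thesis by (simp add: cuntz_s_def)
qed

text \<open>The creation operators are given only as adjoints of the series \<open>rbs\<close>. On vectors \<open>S k u\<close> that
  series has a single nonzero term, and testing against these vectors suffices by \<open>D_ext\<close>.\<close>

lemma boson_creation_1:
  assumes "v \<in> D"
  shows "\<beta> (star (b 1)) (S m v) = sqrt (real (Suc m)) *\<^sub>R S (Suc m) v"
proof (rule D_ext)
  fix k u assume "u \<in> D"
  then have "cinner (S k u) (\<beta> (star (b 1)) (S m v)) =
      of_real (sqrt k) * cinner (S (k - 1) u) (S m v)"
    using boson_adj[of "S k u" "S m v" 0] rbs_1_S[of k u] assms
    by (simp add: D_S cinner_scaleR_left One_nat_def[symmetric])
  \<comment> \<open>For \<open>k = 0\<close> the index \<open>k - 1\<close> is truncated, but the factor \<open>sqrt k\<close> vanishes.\<close>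
  also have "\<dots> = cinner (S k u) (sqrt (real (Suc m)) *\<^sub>R S (Suc m) v)"
    unfolding cinner_scaleR_right cinner_S by (cases k) auto
  finally show "cinner (S k u) (\<beta> (star (b 1)) (S m v)) =
      cinner (S k u) (sqrt (real (Suc m)) *\<^sub>R S (Suc m) v)" .
qed (use assms in \<open>simp_all only: boson_D D_S D_scaleR\<close>)

lemma boson_creation_Suc:
  assumes "v \<in> D"
  shows "\<beta> (star (b (Suc (Suc n)))) (S m v) = S m (\<beta> (star (b (Suc n))) v)"
proof (rule D_ext)
  fix k u assume "u \<in> D"
  then have "cinner (S k u) (\<beta> (star (b (Suc (Suc n)))) (S m v)) =
      cinner (S k (rbs t \<pi> (Suc n) u)) (S m v)"
    using boson_adj[of "S k u" "S m v" "Suc n"] assms by (simp add: D_S rbs_Suc_S)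
  also have "\<dots> = cinner (S k u) (S m (\<beta> (star (b (Suc n))) v))"
    unfolding cinner_S using \<open>u \<in> D\<close> assms by (simp add: boson_adj)
  finally show "cinner (S k u) (\<beta> (star (b (Suc (Suc n)))) (S m v)) =
      cinner (S k u) (S m (\<beta> (star (b (Suc n))) v))" .
qed (use assms in \<open>simp_all only: boson_D D_S\<close>)

text \<open>A vector \<open>(T1 ^^ n) (S m v)\<close> has the first \<open>n\<close> modes empty and the next one occupied \<open>m\<close> times.\<close>

lemma boson_creation:
  assumes "v \<in> D"
  shows "\<beta> (star (b (Suc n))) ((T1 ^^ n) (S m v)) = sqrt (real (Suc m)) *\<^sub>R (T1 ^^ n) (S (Suc m) v)"
proof (induction n)
  case 0
  show ?case using boson_creation_1[OF assms, of m] by (simp add: One_nat_def[symmetric])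
next
  case (Suc n)
  have "\<beta> (star (b (Suc (Suc n)))) (S 0 ((T1 ^^ n) (S m v))) =
      S 0 (\<beta> (star (b (Suc n))) ((T1 ^^ n) (S m v)))"
    by (intro boson_creation_Suc D_T1_funpow D_S assms)
  then show ?case unfolding Suc S_0 by (simp add: op_scaleR)
qed

lemma boson_creation_power:
  assumes "v \<in> D"
  shows "\<beta> (star (b (Suc n)) ^ k) ((T1 ^^ Suc n) v) = sqrt (fact k) *\<^sub>R (T1 ^^ n) (S k v)"
proof (induction k)
  case 0
  show ?case using D_T1_funpow[OF assms, of "Suc n"] unfolding funpow_Suc_right
    by (simp add: boson_one)
next
  case (Suc k)
  have "\<beta> (star (b (Suc n)) ^ Suc k) ((T1 ^^ Suc n) v) =
      \<beta> (star (b (Suc n))) (\<beta> (star (b (Suc n)) ^ k) ((T1 ^^ Suc n) v))"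
    using D_T1_funpow[OF assms, of "Suc n"] boson_mult by (simp only: power_Suc)
  also have "\<dots> = sqrt (fact k) *\<^sub>R sqrt (real (Suc k)) *\<^sub>R (T1 ^^ n) (S (Suc k) v)"
    unfolding Suc using assms by (simp only: boson_scaleR D_T1_funpow D_S boson_creation)
  also have "\<dots> = sqrt (fact (Suc k)) *\<^sub>R (T1 ^^ n) (S (Suc k) v)"
    by (simp add: real_sqrt_mult[symmetric] mult.commute del: power_Suc)
  finally show ?case .
qed

text \<open>The operators with large indices act first. If all their indices exceed \<open>d\<close>, then they leave the
  first \<open>d\<close> modes empty, and the next power acts on an empty mode. The offset \<open>K\<close> only relabels the
  positions.\<close>

lemma boson_monomial_vac:
  "sorted_wrt (<) (map fst nks) \<Longrightarrow> \<forall>(n, k) \<in> set nks. d < n \<Longrightarrow>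
   \<exists>c>0. \<beta> (boson_monomial b nks) \<Omega> = c *\<^sub>R (T1 ^^ d) (config (d + K) (spread K nks))"
proof (induction nks arbitrary: d K)
  case Nil
  show ?case using boson_one[OF D_vac]
    by (intro exI[of _ 1]) (simp add: boson_monomial_def)
next
  case (Cons nk nks)
  obtain m k where nk: "nk = (Suc m, k)" and d: "d \<le> m"
    using Cons.prems by (cases nk, cases "fst nk") auto
  let ?js = "spread (K + k) nks"
  let ?v = "config (Suc m + (K + k)) ?js"
  have gt: "\<forall>(n, k) \<in> set nks. Suc m < n" using Cons.prems nk by auto
  then obtain c where c: "c > 0"
    "\<beta> (boson_monomial b nks) \<Omega> = c *\<^sub>R (T1 ^^ Suc m) ?v"
    using Cons.IH[of "Suc m" "K + k"] Cons.prems by auto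
  have js: "\<forall>j\<in>set ?js. Suc m + (K + k) < j" using spread_greater[OF gt] by blast
  have "config (m + K) (spread K (nk # nks)) = (T2 ^^ k) (config (m + K + k) ?js)"
    using config_run[of "m + K" k ?js] by (simp add: nk del: upt_Suc)
  also have "config (m + K + k) ?js = T1 ?v"
    using config_shift[of "m + K + k" "Suc m + (K + k)" ?js] js by (simp add: add.assoc)
  \<comment> \<open>The run of \<open>k\<close> letters 2, with the letter 1 after it, is one boson factor.\<close>
  finally have run: "config (m + K) (spread K (nk # nks)) = S k ?v" by (simp only: S_eq)
  have "\<forall>j\<in>set (spread K (nk # nks)). m + K < j"
    using spread_greater[of "nk # nks" m _ K] gt nk by fastforce
  then have "(T1 ^^ (m - d)) (config (m + K) (spread K (nk # nks))) = config (d + K) (spread K (nk # nks))"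
    using config_shift[of "d + K" "m + K" "spread K (nk # nks)"] d by simp
  then have "(T1 ^^ d) (config (d + K) (spread K (nk # nks))) = (T1 ^^ m) (S k ?v)"
    using d funpow_add[of d "m - d" T1] unfolding run[symmetric] by simp
  moreover have "\<beta> (boson_monomial b (nk # nks)) \<Omega> = c *\<^sub>R sqrt (fact k) *\<^sub>R (T1 ^^ m) (S k ?v)"
    using boson_mult[OF D_vac, of "star (b (Suc m)) ^ k" "boson_monomial b nks"]
    unfolding c(2) by (simp only: boson_scaleR D_T1_funpow D_config boson_creation_power)
      (simp add: boson_monomial_def nk)
  ultimately show ?case using c(1) by (intro exI[of _ "c * sqrt (fact k)"]) simp
qed

lemma boson_monomial_config:
  assumes "nks \<in> boson_indices"
  shows "\<exists>c>0. \<beta> (boson_monomial b nks) \<Omega> = c *\<^sub>R config 0 (spread 0 nks)"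
  using boson_monomial_vac[of nks 0 0] assms by (auto simp: boson_indices_def Suc_le_eq One_nat_def)

text \<open>A common value of two monomials yields proportional unit vectors. The factor is positive, so
  the vectors agree.\<close>

lemma inj_boson_monomial: "inj_on (boson_monomial b) boson_indices"
proof (rule inj_onI)
  fix nks nks'
  assume nks: "nks \<in> boson_indices" "nks' \<in> boson_indices"
    and eq: "boson_monomial b nks = boson_monomial b nks'"
  obtain c c' where c: "c > 0" "c' > 0"
    "c *\<^sub>R config 0 (spread 0 nks) = c' *\<^sub>R config 0 (spread 0 nks')"
    using boson_monomial_config[OF nks(1)] boson_monomial_config[OF nks(2)] eq by metis
  have "c = c'" using arg_cong[OF c(3), of norm] c(1,2) by (simp add: norm_config)
  then have "config 0 (spread 0 nks) = config 0 (spread 0 nks')" using c by simp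
  moreover have "spread 0 nks \<in> fermion_indices" "spread 0 nks' \<in> fermion_indices"
    using nks bij_betw_spread by (auto simp: bij_betw_def)
  ultimately have "spread 0 nks = spread 0 nks'"
    by (intro config_inject) (auto simp: fermion_indices_def Suc_le_eq One_nat_def)
  then show "nks = nks'"
    using nks by (rule inj_onD[OF bij_betw_imp_inj_on[OF bij_betw_spread]])
qed

end


section \<open>The correspondence\<close>

text \<open>The unitaries carry \<open>\<Omega>\<close> to the two vacua and intertwine the representations, so the claim about
  \<open>U\<close> reduces to the comparison of two vectors in the representation space of the Cuntz algebra.\<close>

theorem corollary1p4:
  fixes t :: "nat \<Rightarrow> 'o::cstar_algebra"
    and b :: "nat \<Rightarrow> 'b::star_algebra"
    and a :: "nat \<Rightarrow> 'a::star_algebra"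
    and \<pi> :: "'o \<Rightarrow> 'h::chilbert_space \<Rightarrow> 'h" and \<Omega> :: 'h
    and \<pi>RBS :: "'b \<Rightarrow> 'h \<Rightarrow> 'h" and \<pi>RFS :: "'a \<Rightarrow> 'h \<Rightarrow> 'h"
    and \<pi>B :: "'b \<Rightarrow> 'hb::chilbert_space \<Rightarrow> 'hb" and \<Omega>B :: 'hb
    and \<pi>F :: "'a \<Rightarrow> 'hf::chilbert_space \<Rightarrow> 'hf" and \<Omega>F :: 'hf
    and VB :: "'h \<Rightarrow> 'hb" and VF :: "'h \<Rightarrow> 'hf" and U :: "'hb \<Rightarrow> 'hf"
  assumes "cuntz_generators t" and "boson_generators b" and "fermion_generators a"
    and "bose_fock b \<pi>B \<Omega>B" and "fermi_fock a \<pi>F \<Omega>F"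
    and "cuntz_cyclic_rep t \<pi> \<Omega>"
    and "rbs_rep t \<pi> \<Omega> b \<pi>RBS" and "rfs_rep t \<pi> a \<pi>RFS"
    and "unitary_equiv_on VB (word_span t \<pi> \<Omega>) \<pi>RBS (orbit \<pi>B \<Omega>B) \<pi>B" and "VB \<Omega> = \<Omega>B"
    and "unitary_equiv_on VF UNIV \<pi>RFS UNIV \<pi>F" and "VF \<Omega> = \<Omega>F"
    and "U = VF \<circ> inv VB"
  shows "\<exists>\<Phi>. bij_betw \<Phi> (boson_monomial b ` boson_indices) (fermion_monomial a ` fermion_indices) \<and>
             (\<forall>nks\<in>boson_indices.
                \<Phi> (boson_monomial b nks) = corresponding_monomial a nks \<and>
                (\<exists>c::real. c > 0 \<and>
                   U (\<pi>B (boson_monomial b nks) \<Omega>B) =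
                     c *\<^sub>R \<pi>F (corresponding_monomial a nks) \<Omega>F))"
proof -
  interpret F: fermion_system t \<pi> \<Omega> a \<pi>RFS
    by unfold_locales (fact assms)+
  interpret B: boson_system t \<pi> \<Omega> b \<pi>RBS
    by unfold_locales (fact assms)
  have "bij_betw (fermion_monomial a \<circ> spread 0) boson_indices (fermion_monomial a ` fermion_indices)"
    using bij_betw_spread F.inj_fermion_monomial
    by (rule bij_betw_trans[OF _ inj_on_imp_bij_betw])
  moreover have "bij_betw (corresponding_monomial a) boson_indices T \<longleftrightarrow>
      bij_betw (fermion_monomial a \<circ> spread 0) boson_indices T" for T
    by (rule bij_betw_cong) (simp add: corresponding_monomial_eq)
  ultimately have F: "bij_betw (corresponding_monomial a) boson_indices (fermion_monomial a ` fermion_indices)"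
    by simp
  have B: "bij_betw (boson_monomial b) boson_indices (boson_monomial b ` boson_indices)"
    using B.inj_boson_monomial by (simp add: bij_betw_def)
  define \<Phi> where "\<Phi> = corresponding_monomial a \<circ> inv_into boson_indices (boson_monomial b)"
  have "bij_betw \<Phi> (boson_monomial b ` boson_indices) (fermion_monomial a ` fermion_indices)"
    unfolding \<Phi>_def using bij_betw_inv_into[OF B] F by (rule bij_betw_trans)
  moreover have "\<Phi> (boson_monomial b nks) = corresponding_monomial a nks"
    if "nks \<in> boson_indices" for nks
    using that B.inj_boson_monomial by (simp add: \<Phi>_def)
  moreover have "\<exists>c::real. c > 0 \<and> U (\<pi>B (boson_monomial b nks) \<Omega>B) =
      c *\<^sub>R \<pi>F (corresponding_monomial a nks) \<Omega>F" if nks: "nks \<in> boson_indices" for nks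
  proof -
    obtain c where c: "c > 0"
      "\<pi>RBS (boson_monomial b nks) \<Omega> = c *\<^sub>R F.config 0 (spread 0 nks)"
      using B.boson_monomial_config[OF nks] by blast
    have "spread 0 nks \<in> fermion_indices" using nks bij_betw_spread by (auto simp: bij_betw_def)
    then have f: "\<pi>RFS (corresponding_monomial a nks) \<Omega> = F.config 0 (spread 0 nks)"
      using F.fermion_monomial_vac[of "spread 0 nks"] nks
      by (auto simp: corresponding_monomial_eq fermion_indices_def Suc_le_eq One_nat_def)
    have "VB \<Omega> \<in> orbit \<pi>B \<Omega>B" using assms(4,10) by (simp add: bose_fock_def)
    then have "\<pi>B (boson_monomial b nks) \<Omega>B = VB (\<pi>RBS (boson_monomial b nks) \<Omega>)"
      using unitary_equiv_on_apply[OF assms(9), of \<Omega>] assms(10) by simp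
    then have "U (\<pi>B (boson_monomial b nks) \<Omega>B) = VF (\<pi>RBS (boson_monomial b nks) \<Omega>)"
      using assms(9,13) by (simp add: unitary_equiv_on_def unitary_inv)
    also have "\<dots> = c *\<^sub>R VF (\<pi>RFS (corresponding_monomial a nks) \<Omega>)"
      using assms(11) unfolding c(2) f by (simp add: unitary_equiv_on_def unitary_def scaleR_scaleC)
    also have "VF (\<pi>RFS (corresponding_monomial a nks) \<Omega>) = \<pi>F (corresponding_monomial a nks) \<Omega>F"
      using unitary_equiv_on_apply[OF assms(11), of \<Omega>] assms(12) by simp
    finally show ?thesis using c(1) by blast
  qed
  ultimately show ?thesis by blast
qed

end
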